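(* Let $\mathcal{A}=(A,\to_\mathcal{A})$ be an abstract reduction system and $P\Rightarrow Q$ an APR predicate over $A$. Then: (1) if there exists an APR proof for $P\Rightarrow Q$ w.r.t. $\mathcal{A}$, then $P\Rightarrow Q$ is partially valid w.r.t. $\mathcal{A}$; and (2) if there exists an APR disproof of $P\Rightarrow Q$ w.r.t. $\mathcal{A}$, then $P\Rightarrow Q$ is not partially valid w.r.t. $\mathcal{A}$.
   Context: An abstract reduction system (ARS) is a pair $\mathcal{A}=(A,\to_\mathcal{A})$ of a set $A$ and a binary relation on $A$. $\mathrm{NF}_\mathcal{A}$ is the set of normal forms. $\Delta_\mathcal{A}(P)=\{t\mid\exists s\in P.\ s\to_\mathcal{A}t\}$. $P$ is $\mathcal{A}$-runnable if $P\neq\emptyset$ and $P\cap\mathrm{NF}_\mathcal{A}=\emptyset$. An APR predicate is a pair $P\Rightarrow Q$ with $P,Q\subseteq A$. $P\Rightarrow Q$ is partially valid w.r.t. $\mathcal{A}$ if it lies in the greatest fixed point of the functional (mapping a set $X$ of predicates to the conclusions of rule instances with all premises in $X$ and side conditions true) of the rules (Subsumption) no premises, conclude $P\Rightarrow Q$ if $P\subseteq Q$; (Step) from $\Delta_\mathcal{A}(P\setminus Q)\Rightarrow Q$ conclude $P\Rightarrow Q$ if $P\setminus Q$ is $\mathcal{A}$-runnable. Rules of $\mathrm{CDVP}'_\mathcal{A}$ (conclusion $P\Rightarrow Q$; $\bot$ denotes "invalid"): (Axiom) no premises, if $P=\emptyset$. (Subs) premises $P_i\Rightarrow Q$ ($1\le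 i\le n$), if $P\cap Q\neq\emptyset$, where $P\setminus Q=\bigcup_i P_i$, $n>0$, and if $n>1$ then $\emptyset\subsetneq P_i\subseteq P$. (Der) premises $P_i\Rightarrow Q$ ($1\le i\le n$), if $P\cap Q=\emptyset$ and $P$ is $\mathcal{A}$-runnable, where $\Delta_\mathcal{A}(P)=\bigcup_iP_i$, $n>0$, all $P_i\neq\emptyset$. (Dis) premise $\bot$, if $P\cap Q=\emptyset$, $P\ne\emptyset$, $P\cap\mathrm{NF}_\mathcal{A}\neq\emptyset$. An APR derivation tree is a finite tree $(V,a,r,p)$ with root $v_0$: $a$ is a total map labeling each node with an APR predicate or $\bot$, $r$ is a partial map assigning a rule of $\mathrm{CDVP}'_\mathcal{A}$, $p$ a partial map assigning the sequence of children, such that $p(v)$ is defined (as the list of $k$ children) exactly when $r(v)$ is a rule with $k$ premises and the children's labels over $a(v)$ form an instance of $r(v)$ ($p(v)=\varepsilon$ if $k=0$). A leaf ($p(v)=\varepsilon$ or undefined) is closed if $p(v)=\varepsilon$ or $a(v)=\bot$, else open; $V_{open}$ is the set of open leaves. An APR pre-proof for $P\Rightarrow Q$ is a pair $(\mathcal{T},\xi)$ of such a tree $\mathcal{T}$ with $a(v_0)=(P\Rightarrow Q)$ and a partial map $\xi: V_{open}\to V\setminus V_{open}$ such that whenever $\xi(v)$ is defined, $a(v)=a(\xi(v))$ and $r(\xi(v))=\mathrm{Der}$ (such $v$ is a bud, $\xi(v)$ its companion). An APR proof is a pre-proof in which $\xi$ is defined on all of $V_{open}$. An APR disproof is a pre-proof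 containing a node $v$ with $r(v)=\mathrm{Dis}$.
   Formalization: An APR proof is additionally required to contain no node using rule Dis; otherwise the two-node tree deriving {a}⇒∅ (a a normal form) from ⊥ by Dis has no open leaves and would count as a proof of a predicate that is not partially valid. *)

theory Defs
  imports Main
begin

record 'a ars =
  carrier :: "'a set"
  step :: "('a \<times> 'a) set"

definition is_ars :: "'a ars \<Rightarrow> bool" where
  "is_ars \<A> \<longleftrightarrow> step \<A> \<subseteq> carrier \<A> \<times> carrier \<A>"

definition NF :: "'a ars \<Rightarrow> 'a set" where
  "NF \<A> = {s \<in> carrier \<A>. \<not> (\<exists>t. (s, t) \<in> step \<A>)}"

definition Delta :: "'a ars \<Rightarrow> 'a set \<Rightarrow> 'a set" where
  "Delta \<A> P = {t. \<exists>s\<in>P. (s, t) \<in> step \<A>}"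

definition runnable :: "'a ars \<Rightarrow> 'a set \<Rightarrow> bool" where
  "runnable \<A> P \<longleftrightarrow> P \<noteq> {} \<and> P \<inter> NF \<A> = {}"

datatype 'a apr = APR "'a set" "'a set"  (infix \<open>\<leadsto>\<close> 45)

definition apr_over :: "'a ars \<Rightarrow> 'a apr set" where
  "apr_over \<A> = {P \<leadsto> Q | P Q. P \<subseteq> carrier \<A> \<and> Q \<subseteq> carrier \<A>}"


subsection \<open>Partial validity\<close>

inductive pv_rule :: "'a ars \<Rightarrow> 'a apr set \<Rightarrow> 'a apr \<Rightarrow> bool" for \<A> where
  Subsumption: "P \<subseteq> Q \<Longrightarrow> pv_rule \<A> {} (P \<leadsto> Q)"
| Step: "runnable \<A> (P - Q) \<Longrightarrow> pv_rule \<A> {Delta \<A> (P - Q) \<leadsto> Q} (P \<leadsto> Q)"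

definition pv_functional :: "'a ars \<Rightarrow> 'a apr set \<Rightarrow> 'a apr set" where
  "pv_functional \<A> X = {\<phi> \<in> apr_over \<A>. \<exists>prems. pv_rule \<A> prems \<phi> \<and> prems \<subseteq> X}"

lemma mono_pv_functional: "mono (pv_functional \<A>)"
  unfolding pv_functional_def by (rule monoI) blast

definition partially_valid :: "'a ars \<Rightarrow> 'a apr \<Rightarrow> bool" where
  "partially_valid \<A> \<phi> \<longleftrightarrow> \<phi> \<in> gfp (pv_functional \<A>)"


subsection \<open>The proof system\<close>

datatype cdvp_rule = Axiom | Subs | Der | Dis

datatype 'a label = Pred "'a apr" | Invalid

text \<open>\<open>rule_instance \<A> \<rho> ls l\<close>: the premises \<open>ls\<close> over the conclusion \<open>l\<close> form an instance
  of the rule \<open>\<rho>\<close>, all side conditions being true.\<close>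

inductive rule_instance :: "'a ars \<Rightarrow> cdvp_rule \<Rightarrow> 'a label list \<Rightarrow> 'a label \<Rightarrow> bool"
  for \<A> where
  Axiom: "P = {} \<Longrightarrow> rule_instance \<A> Axiom [] (Pred (P \<leadsto> Q))"
| Subs: "P \<inter> Q \<noteq> {} \<Longrightarrow> P - Q = \<Union> (set Ps) \<Longrightarrow> length Ps > 0 \<Longrightarrow>
    (length Ps > 1 \<longrightarrow> (\<forall>P'\<in>set Ps. {} \<subset> P' \<and> P' \<subseteq> P)) \<Longrightarrow>
    rule_instance \<A> Subs (map (\<lambda>P'. Pred (P' \<leadsto> Q)) Ps) (Pred (P \<leadsto> Q))"
| Der: "P \<inter> Q = {} \<Longrightarrow> runnable \<A> P \<Longrightarrow> Delta \<A> P = \<Union> (set Ps) \<Longrightarrow> length Ps > 0 \<Longrightarrow>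
    (\<forall>P'\<in>set Ps. P' \<noteq> {}) \<Longrightarrow>
    rule_instance \<A> Der (map (\<lambda>P'. Pred (P' \<leadsto> Q)) Ps) (Pred (P \<leadsto> Q))"
| Dis: "P \<inter> Q = {} \<Longrightarrow> P \<noteq> {} \<Longrightarrow> P \<inter> NF \<A> \<noteq> {} \<Longrightarrow>
    rule_instance \<A> Dis [Invalid] (Pred (P \<leadsto> Q))"


subsection \<open>Derivation trees\<close>

record ('v, 'a) dtree =
  nodes :: "'v set"
  root :: 'v
  label :: "'v \<Rightarrow> 'a label"
  rule :: "'v \<rightharpoonup> cdvp_rule"
  children :: "'v \<rightharpoonup> 'v list"

definition edges :: "('v, 'a) dtree \<Rightarrow> ('v \<times> 'v) set" where
  "edges T = {(u, v). u \<in> nodes T \<and> (\<exists>vs. children T u = Some vs \<and> v \<in> set vs)}"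

definition finite_tree :: "('v, 'a) dtree \<Rightarrow> bool" where
  "finite_tree T \<longleftrightarrow>
     finite (nodes T) \<and> root T \<in> nodes T \<and>
     dom (children T) \<subseteq> nodes T \<and> edges T \<subseteq> nodes T \<times> nodes T \<and>
     (\<forall>u vs. children T u = Some vs \<longrightarrow> distinct vs) \<and>
     (\<forall>u. (u, root T) \<notin> edges T) \<and>
     (\<forall>u u' v. (u, v) \<in> edges T \<longrightarrow> (u', v) \<in> edges T \<longrightarrow> u = u') \<and>
     (\<forall>v\<in>nodes T. (root T, v) \<in> (edges T)\<^sup>*)"

definition derivation_tree :: "'a ars \<Rightarrow> ('v, 'a) dtree \<Rightarrow> bool" where
  "derivation_tree \<A> T \<longleftrightarrow>
     finite_tree T \<and>
     (\<forall>v\<in>nodes T. \<forall>\<phi>. label T v = Pred \<phi> \<longrightarrow> \<phi> \<in> apr_over \<A>) \<and>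
     dom (rule T) = dom (children T) \<and>
     (\<forall>v \<rho> vs. rule T v = Some \<rho> \<longrightarrow> children T v = Some vs \<longrightarrow>
        rule_instance \<A> \<rho> (map (label T) vs) (label T v))"

definition leaves :: "('v, 'a) dtree \<Rightarrow> 'v set" where
  "leaves T = {v \<in> nodes T. children T v = Some [] \<or> children T v = None}"

definition closed_leaves :: "('v, 'a) dtree \<Rightarrow> 'v set" where
  "closed_leaves T = {v \<in> leaves T. children T v = Some [] \<or> label T v = Invalid}"

definition open_leaves :: "('v, 'a) dtree \<Rightarrow> 'v set" where
  "open_leaves T = leaves T - closed_leaves T"


subsection \<open>Proofs and disproofs\<close>

definition apr_pre_proof ::
  "'a ars \<Rightarrow> 'a apr \<Rightarrow> ('v, 'a) dtree \<Rightarrow> ('v \<rightharpoonup> 'v) \<Rightarrow> bool" where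
  "apr_pre_proof \<A> \<phi> T \<xi> \<longleftrightarrow>
     derivation_tree \<A> T \<and> label T (root T) = Pred \<phi> \<and>
     dom \<xi> \<subseteq> open_leaves T \<and> ran \<xi> \<subseteq> nodes T - open_leaves T \<and>
     (\<forall>v w. \<xi> v = Some w \<longrightarrow> label T v = label T w \<and> rule T w = Some Der)"

definition apr_disproof ::
  "'a ars \<Rightarrow> 'a apr \<Rightarrow> ('v, 'a) dtree \<Rightarrow> ('v \<rightharpoonup> 'v) \<Rightarrow> bool" where
  "apr_disproof \<A> \<phi> T \<xi> \<longleftrightarrow>
     apr_pre_proof \<A> \<phi> T \<xi> \<and> (\<exists>v\<in>nodes T. rule T v = Some Dis)"

text \<open>Leaves labelled \<open>Invalid\<close> count as closed, so a tree using \<open>Dis\<close> can satisfy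
  \<open>dom \<xi> = open_leaves T\<close>. Such a tree is a disproof and must not also count as a proof, hence
  the last conjunct; lemma \<open>open_leaves_covered_unsound\<close> below shows that soundness fails
  without it.\<close>

definition apr_proof ::
  "'a ars \<Rightarrow> 'a apr \<Rightarrow> ('v, 'a) dtree \<Rightarrow> ('v \<rightharpoonup> 'v) \<Rightarrow> bool" where
  "apr_proof \<A> \<phi> T \<xi> \<longleftrightarrow>
     apr_pre_proof \<A> \<phi> T \<xi> \<and> dom \<xi> = open_leaves T \<and>
     (\<forall>v\<in>nodes T. rule T v \<noteq> Some Dis)"

lemma open_leaves_covered_unsound:
  "\<exists>(\<A> :: unit ars) \<phi> (T :: (bool, unit) dtree) \<xi>.
     is_ars \<A> \<and> \<phi> \<in> apr_over \<A> \<and> apr_pre_proof \<A> \<phi> T \<xi> \<and> dom \<xi> = open_leaves T \<and>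
     \<not> partially_valid \<A> \<phi>"
proof -
  define \<A> :: "unit ars" where "\<A> = \<lparr>carrier = UNIV, step = {}\<rparr>"
  define \<phi> :: "unit apr" where "\<phi> = (UNIV \<leadsto> {})"
  define T :: "(bool, unit) dtree" where
    "T = \<lparr>nodes = UNIV, root = False, label = (\<lambda>b. if b then Invalid else Pred \<phi>),
          rule = [False \<mapsto> Dis], children = [False \<mapsto> [True]]\<rparr>"
  have edges: "edges T = {(False, True)}"
    by (auto simp: edges_def T_def split: if_splits)
  have "(False, v) \<in> {(False, True)}\<^sup>*" for v
    by (cases v) auto
  then have "finite_tree T"
    unfolding finite_tree_def edges by (auto simp: T_def split: if_splits)
  moreover have "rule_instance \<A> Dis [Invalid] (Pred \<phi>)"
    unfolding \<phi>_def by (rule rule_instance.Dis) (auto simp: NF_def \<A>_def)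
  moreover have over: "\<phi> \<in> apr_over \<A>"
    by (auto simp: apr_over_def \<phi>_def \<A>_def)
  ultimately have tree: "derivation_tree \<A> T"
    by (auto simp: derivation_tree_def T_def split: if_splits)
  have no_open: "open_leaves T = {}"
    by (auto simp: open_leaves_def closed_leaves_def leaves_def T_def)
  have pre: "apr_pre_proof \<A> \<phi> T Map.empty"
    using tree by (auto simp: apr_pre_proof_def T_def)
  have "\<not> partially_valid \<A> \<phi>"
  proof
    assume "partially_valid \<A> \<phi>"
    then have "\<phi> \<in> pv_functional \<A> (gfp (pv_functional \<A>))"
      unfolding partially_valid_def using gfp_unfold[OF mono_pv_functional] by blast
    then obtain prems where "pv_rule \<A> prems \<phi>"
      by (auto simp: pv_functional_def)
    then show False
      by cases (auto simp: \<phi>_def \<A>_def runnable_def NF_def)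
  qed
  moreover have "is_ars \<A>"
    by (simp add: is_ars_def \<A>_def)
  ultimately show ?thesis
    using over pre no_open by (metis dom_empty)
qed

end

theory Submission
  imports Defs
begin

text \<open>Partial validity of \<open>P \<leadsto> Q\<close> means that no element of \<open>P\<close> reaches a normal form along a path
  avoiding \<open>Q\<close>. Such a path starting in the label of a node of a proof leads to a node whose label
  contains the start of a shorter such path: it is shortened at each \<open>Der\<close> node, and every other
  node passes to a \<open>Der\<close> node in at most two steps, since the premises of \<open>Subs\<close> are disjoint from
  \<open>Q\<close> and companions are \<open>Der\<close> nodes. Conversely, the normal form at a \<open>Dis\<close> node yields an
  escaping path at each of its ancestors.\<close>

section \<open>Escaping paths and partial validity\<close>

inductive escapes :: "'a ars \<Rightarrow> 'a set \<Rightarrow> 'a \<Rightarrow> bool" for \<A> Q where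
  escapes_NF: "s \<in> NF \<A> \<Longrightarrow> s \<notin> Q \<Longrightarrow> escapes \<A> Q s"
| escapes_step: "s \<notin> Q \<Longrightarrow> (s, t) \<in> step \<A> \<Longrightarrow> escapes \<A> Q t \<Longrightarrow> escapes \<A> Q s"

lemma partially_valid_cases:
  assumes "partially_valid \<A> (P \<leadsto> Q)"
  obtains "P \<subseteq> Q"
  | "runnable \<A> (P - Q)" and "partially_valid \<A> (Delta \<A> (P - Q) \<leadsto> Q)"
proof -
  have "(P \<leadsto> Q) \<in> pv_functional \<A> (gfp (pv_functional \<A>))"
    using assms gfp_unfold[OF mono_pv_functional] unfolding partially_valid_def by blast
  then obtain prems where "pv_rule \<A> prems (P \<leadsto> Q)" and "prems \<subseteq> gfp (pv_functional \<A>)"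
    by (auto simp: pv_functional_def)
  then show thesis
    by cases (auto simp: partially_valid_def intro: that)
qed

text \<open>Each step of the path unfolds the greatest fixed point once: an element of
  \<open>P\<close> outside \<open>Q\<close> rules out Subsumption, so Step applies and places the
  next element in the new left-hand side. At the final normal form Step fails too, by
  runnability.\<close>

lemma partially_valid_imp_no_escape:
  assumes "escapes \<A> Q s" and "partially_valid \<A> (P \<leadsto> Q)"
  shows "s \<notin> P"
  using assms
proof (induction arbitrary: P rule: escapes.induct)
  case (escapes_NF s)
  from escapes_NF.prems show ?case
    by (cases rule: partially_valid_cases) (use escapes_NF.hyps in \<open>auto simp: runnable_def\<close>)
next
  case (escapes_step s t)
  from escapes_step.prems show ?case
  proof (cases rule: partially_valid_cases)
    case 1
    then show ?thesis using escapes_step.hyps by blast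
  next
    case 2
    then have "t \<notin> Delta \<A> (P - Q)" using escapes_step.IH by blast
    then show ?thesis using escapes_step.hyps by (auto simp: Delta_def)
  qed
qed

text \<open>Coinduction: the escape-free predicates over the carrier form a post-fixed point of
  \<open>pv_functional\<close>, hence lie in its greatest fixed point.\<close>

lemma no_escape_imp_partially_valid:
  assumes "is_ars \<A>" and "(P \<leadsto> Q) \<in> apr_over \<A>" and "\<And>s. s \<in> P \<Longrightarrow> \<not> escapes \<A> Q s"
  shows "partially_valid \<A> (P \<leadsto> Q)"
proof -
  define X where "X = {P \<leadsto> Q | P Q. (P \<leadsto> Q) \<in> apr_over \<A> \<and> (\<forall>s\<in>P. \<not> escapes \<A> Q s)}"
  have "X \<subseteq> pv_functional \<A> X"
  proof
    fix \<phi> assume "\<phi> \<in> X"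
    then obtain P Q where \<phi>: "\<phi> = (P \<leadsto> Q)" "\<phi> \<in> apr_over \<A>"
      and no: "\<And>s. s \<in> P \<Longrightarrow> \<not> escapes \<A> Q s"
      by (auto simp: X_def)
    show "\<phi> \<in> pv_functional \<A> X"
    proof (cases "P \<subseteq> Q")
      case True
      then show ?thesis
        using \<phi> pv_rule.Subsumption[OF True, of \<A>] unfolding pv_functional_def by blast
    next
      case False
      \<comment> \<open>A normal form in \<open>P - Q\<close> would be an escaping path of length
        zero.\<close>
      have "runnable \<A> (P - Q)"
        using False no by (auto simp: runnable_def intro: escapes_NF)
      moreover have "(Delta \<A> (P - Q) \<leadsto> Q) \<in> X"
      proof -
        have "\<not> escapes \<A> Q t" if "t \<in> Delta \<A> (P - Q)" for t
          using that no escapes_step[of _ Q t \<A>] unfolding Delta_def by blast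
        then show ?thesis
          \<comment> \<open>\<open>is_ars\<close> keeps the successors inside the carrier, as
            \<open>apr_over\<close> demands.\<close>
          using \<phi> \<open>is_ars \<A>\<close> by (auto simp: X_def apr_over_def Delta_def is_ars_def)
      qed
      ultimately show ?thesis
        using \<phi> pv_rule.Step[of \<A> P Q] unfolding pv_functional_def by blast
    qed
  qed
  then have "X \<subseteq> gfp (pv_functional \<A>)"
    by (rule gfp_upperbound)
  then show ?thesis
    using assms(2,3) by (auto simp: X_def partially_valid_def)
qed

section \<open>Proofs admit no escaping paths\<close>

inductive_cases rule_instance_AxiomE: "rule_instance \<A> Axiom ls (Pred (P \<leadsto> Q))"
inductive_cases rule_instance_SubsE: "rule_instance \<A> Subs ls (Pred (P \<leadsto> Q))"
inductive_cases rule_instance_DerE: "rule_instance \<A> Der ls (Pred (P \<leadsto> Q))"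

lemma derivation_tree_rule_instance:
  assumes "derivation_tree \<A> T" and "rule T v = Some \<rho>"
  obtains vs where "children T v = Some vs" and "set vs \<subseteq> nodes T"
    and "rule_instance \<A> \<rho> (map (label T) vs) (label T v)"
proof -
  have tree: "finite_tree T" "dom (rule T) = dom (children T)"
    using assms(1) by (auto simp: derivation_tree_def)
  then obtain vs where vs: "children T v = Some vs"
    using assms(2) by blast
  then have "v \<in> nodes T" and "edges T \<subseteq> nodes T \<times> nodes T"
    using tree by (auto simp: finite_tree_def)
  then have "set vs \<subseteq> nodes T"
    using vs by (auto simp: edges_def)
  moreover have "rule_instance \<A> \<rho> (map (label T) vs) (label T v)"
    using vs assms unfolding derivation_tree_def by blast
  ultimately show thesis
    using that vs by blast
qed

text \<open>Without a rule and with a label other than \<open>Invalid\<close>, \<open>v\<close> is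
  an open leaf, so \<open>\<xi>\<close> gives it a companion.\<close>

lemma apr_proof_open_node:
  assumes "apr_proof \<A> \<phi> T \<xi>" and "v \<in> nodes T" and "label T v = Pred \<psi>" and "rule T v = None"
  obtains w where "w \<in> nodes T" and "label T w = Pred \<psi>" and "rule T w = Some Der"
proof -
  have "children T v = None"
    using assms(1,4) by (auto simp: apr_proof_def apr_pre_proof_def derivation_tree_def)
  then have "v \<in> dom \<xi>"
    using assms by (auto simp: apr_proof_def open_leaves_def leaves_def closed_leaves_def)
  then obtain w where "\<xi> v = Some w" by blast
  moreover have "\<forall>v w. \<xi> v = Some w \<longrightarrow> label T v = label T w \<and> rule T w = Some Der"
    and "ran \<xi> \<subseteq> nodes T"
    using assms(1) unfolding apr_proof_def apr_pre_proof_def by blast+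
  ultimately have "w \<in> nodes T" "label T w = Pred \<psi>" "rule T w = Some Der"
    using assms(3) by (auto intro: ranI)
  then show thesis by (rule that)
qed

text \<open>Isolates \<open>Der\<close>, the only rule that consumes a step of a path. No induction
  on the tree is needed, because a premise of \<open>Subs\<close> is never itself concluded by
  \<open>Subs\<close>.\<close>

lemma apr_proof_reduce_to_Der:
  assumes pf: "apr_proof \<A> \<phi> T \<xi>"
    and Der: "\<And>v P. v \<in> nodes T \<Longrightarrow> label T v = Pred (P \<leadsto> Q) \<Longrightarrow> rule T v = Some Der \<Longrightarrow> s \<notin> P"
    and "s \<notin> Q" and v: "v \<in> nodes T" "label T v = Pred (P \<leadsto> Q)"
  shows "s \<notin> P"
proof -
  have tree: "derivation_tree \<A> T" and no_Dis: "\<And>v. v \<in> nodes T \<Longrightarrow> rule T v \<noteq> Some Dis"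
    using pf by (auto simp: apr_proof_def apr_pre_proof_def)
  have not_Subs: "s \<notin> P"
    if v: "v \<in> nodes T" "label T v = Pred (P \<leadsto> Q)" "rule T v \<noteq> Some Subs" for v P
  proof (cases "rule T v")
    case None
    then show ?thesis
      using apr_proof_open_node[OF pf v(1,2)] Der by metis
  next
    case (Some \<rho>)
    from tree Some obtain vs where "rule_instance \<A> \<rho> (map (label T) vs) (label T v)"
      by (rule derivation_tree_rule_instance)
    then have inst: "rule_instance \<A> \<rho> (map (label T) vs) (Pred (P \<leadsto> Q))"
      unfolding v(2) .
    show ?thesis
    proof (cases \<rho>)
      case Axiom
      with inst have "P = {}" by (blast elim: rule_instance_AxiomE)
      then show ?thesis by blast
    next
      case Der
      then show ?thesis using Some v(1,2) assms(2) by blast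
    \<comment> \<open>\<open>Subs\<close> is excluded by assumption here, and \<open>Dis\<close>
      because the tree is a proof.\<close>
    qed (use Some v no_Dis in auto)
  qed
  show ?thesis
  proof (cases "rule T v = Some Subs")
    case False
    then show ?thesis using not_Subs[OF v] by blast
  next
    case True
    obtain vs where vs: "set vs \<subseteq> nodes T"
      and inst: "rule_instance \<A> Subs (map (label T) vs) (label T v)"
      by (rule derivation_tree_rule_instance[OF tree True]) (rule that)
    from inst[unfolded v(2)] obtain Ps where Ps: "map (label T) vs = map (\<lambda>P'. Pred (P' \<leadsto> Q)) Ps"
      and P: "P - Q = \<Union> (set Ps)"
      by (rule rule_instance_SubsE)
    have "s \<notin> P'" if "P' \<in> set Ps" for P'
    proof -
      have "Pred (P' \<leadsto> Q) \<in> set (map (label T) vs)"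
        unfolding Ps using that by simp
      then obtain w where w: "w \<in> nodes T" "label T w = Pred (P' \<leadsto> Q)"
        using vs by auto
      \<comment> \<open>The premises of \<open>Subs\<close> cover exactly \<open>P - Q\<close>, so
        they avoid \<open>Q\<close>; this violates the side condition of a second
        \<open>Subs\<close>.\<close>
      have disj: "P' \<inter> Q = {}" using P that by blast
      show ?thesis
      proof (cases "rule T w = Some Subs")
        case True
        obtain ws where "rule_instance \<A> Subs (map (label T) ws) (label T w)"
          by (rule derivation_tree_rule_instance[OF tree True]) (rule that)
        then have "P' \<inter> Q \<noteq> {}"
          unfolding w(2) by (rule rule_instance_SubsE)
        then show ?thesis using disj by blast
      next
        case False
        then show ?thesis using not_Subs[OF w] by blast
      qed
    qed
    then show ?thesis using P \<open>s \<notin> Q\<close> by blast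
  qed
qed

text \<open>The induction is on the path, with the node arbitrary: the hypothesis for the shorter
  path covers all nodes at once, so returning from a bud to its companion is not circular.\<close>

lemma apr_proof_no_escape:
  assumes "escapes \<A> Q s" and pf: "apr_proof \<A> \<phi> T \<xi>"
    and "v \<in> nodes T" and "label T v = Pred (P \<leadsto> Q)"
  shows "s \<notin> P"
proof -
  have tree: "derivation_tree \<A> T"
    using pf by (auto simp: apr_proof_def apr_pre_proof_def)
  show ?thesis
    using assms(1,3,4)
  proof (induction arbitrary: v P rule: escapes.induct)
    case (escapes_NF s)
    show ?case
    proof (rule apr_proof_reduce_to_Der[OF pf _ escapes_NF.hyps(2) escapes_NF.prems])
      fix v P assume v: "label T v = Pred (P \<leadsto> Q)" "rule T v = Some Der"
      obtain vs where "rule_instance \<A> Der (map (label T) vs) (label T v)"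
        by (rule derivation_tree_rule_instance[OF tree v(2)]) (rule that)
      then have "runnable \<A> P"
        unfolding v(1) by (rule rule_instance_DerE)
      then show "s \<notin> P"
        using escapes_NF.hyps by (auto simp: runnable_def)
    qed
  next
    case (escapes_step s t)
    show ?case
    proof (rule apr_proof_reduce_to_Der[OF pf _ escapes_step.hyps(1) escapes_step.prems])
      fix v P assume v: "label T v = Pred (P \<leadsto> Q)" "rule T v = Some Der"
      obtain vs where vs: "set vs \<subseteq> nodes T"
        and inst: "rule_instance \<A> Der (map (label T) vs) (label T v)"
        by (rule derivation_tree_rule_instance[OF tree v(2)]) (rule that)
      from inst[unfolded v(1)] obtain Ps where Ps: "map (label T) vs = map (\<lambda>P'. Pred (P' \<leadsto> Q)) Ps"
        and P: "Delta \<A> P = \<Union> (set Ps)"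
        by (rule rule_instance_DerE)
      have "t \<notin> P'" if "P' \<in> set Ps" for P'
      proof -
        have "Pred (P' \<leadsto> Q) \<in> set (map (label T) vs)"
          unfolding Ps using that by simp
        then obtain w where "w \<in> nodes T" "label T w = Pred (P' \<leadsto> Q)"
          using vs by auto
        \<comment> \<open>The tail of the path, starting at \<open>t\<close>, is handled at the
          child \<open>w\<close>.\<close>
        then show ?thesis using escapes_step.IH by blast
      qed
      then have "t \<notin> Delta \<A> P" using P by blast
      then show "s \<notin> P" using escapes_step.hyps by (auto simp: Delta_def)
    qed
  qed
qed

section \<open>Disproofs force an escaping path at the root\<close>

text \<open>Under \<open>Subs\<close> the start stays the same, as the premises are parts of
  \<open>P\<close>. Under \<open>Der\<close> it has a predecessor in \<open>P\<close>, which lies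
  outside \<open>Q\<close> by the side condition and prolongs the path.\<close>

lemma rule_instance_premise_escape:
  assumes "rule_instance \<A> \<rho> ls l" and "Pred (P' \<leadsto> Q) \<in> set ls" and "s \<in> P'" and "escapes \<A> Q s"
  shows "\<exists>P t. l = Pred (P \<leadsto> Q) \<and> t \<in> P \<and> escapes \<A> Q t"
  using assms
proof cases
  case (Subs P Q' Ps)
  then have "Q' = Q" "P' \<in> set Ps"
    using assms(2) by auto
  then have "s \<in> P"
    using Subs(5) assms(3) by blast
  then show ?thesis
    using Subs(3) \<open>Q' = Q\<close> assms(4) by blast
next
  case (Der P Q' Ps)
  then have "Q' = Q" "P' \<in> set Ps"
    using assms(2) by auto
  then have "s \<in> Delta \<A> P"
    using Der(6) assms(3) by blast
  then obtain t where "t \<in> P" "(t, s) \<in> step \<A>"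
    by (auto simp: Delta_def)
  moreover have "t \<notin> Q"
    using \<open>t \<in> P\<close> Der(4) \<open>Q' = Q\<close> by blast
  ultimately show ?thesis
    using Der(3) \<open>Q' = Q\<close> assms(4) escapes_step by metis
\<comment> \<open>\<open>Axiom\<close> has no premises, and the only premise of \<open>Dis\<close>
  is \<open>Invalid\<close>.\<close>
qed auto

text \<open>Induction up the edges from \<open>v\<close>, where the side conditions of
  \<open>Dis\<close> provide a normal form in the left-hand side and outside
  \<open>Q\<close>.\<close>

lemma Dis_below_imp_escape:
  assumes tree: "derivation_tree \<A> T" and v: "rule T v = Some Dis" and "(u, v) \<in> (edges T)\<^sup>*"
  shows "\<exists>P Q s. label T u = Pred (P \<leadsto> Q) \<and> s \<in> P \<and> escapes \<A> Q s"
  using assms(3)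
proof (induction rule: converse_rtrancl_induct)
  case base
  obtain vs where "rule_instance \<A> Dis (map (label T) vs) (label T v)"
    by (rule derivation_tree_rule_instance[OF tree v]) (rule that)
  then show ?case
    by cases (auto intro: escapes_NF)
next
  case (step u w)
  then obtain P' Q s where w: "label T w = Pred (P' \<leadsto> Q)" "s \<in> P'" "escapes \<A> Q s"
    by blast
  from step obtain vs where vs: "children T u = Some vs" "w \<in> set vs"
    by (auto simp: edges_def)
  moreover obtain \<rho> where "rule T u = Some \<rho>"
    using vs(1) tree by (metis derivation_tree_def domD domI)
  ultimately have "rule_instance \<A> \<rho> (map (label T) vs) (label T u)"
    using tree by (auto simp: derivation_tree_def)
  moreover have "Pred (P' \<leadsto> Q) \<in> set (map (label T) vs)"
    using vs w by force
  ultimately show ?case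
    using rule_instance_premise_escape w by metis
qed

theorem theorem20:
  fixes \<A> :: "'a ars" and P Q :: "'a set"
  assumes "is_ars \<A>" and "P \<subseteq> carrier \<A>" and "Q \<subseteq> carrier \<A>"
  shows "((\<exists>(T :: ('v, 'a) dtree) \<xi>. apr_proof \<A> (P \<leadsto> Q) T \<xi>) \<longrightarrow> partially_valid \<A> (P \<leadsto> Q)) \<and>
         ((\<exists>(T :: ('v, 'a) dtree) \<xi>. apr_disproof \<A> (P \<leadsto> Q) T \<xi>) \<longrightarrow> \<not> partially_valid \<A> (P \<leadsto> Q))"
proof (intro conjI impI; elim exE)
  fix T :: "('v, 'a) dtree" and \<xi>
  assume pf: "apr_proof \<A> (P \<leadsto> Q) T \<xi>"
  then have "root T \<in> nodes T" "label T (root T) = Pred (P \<leadsto> Q)"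
    by (auto simp: apr_proof_def apr_pre_proof_def derivation_tree_def finite_tree_def)
  then have "\<not> escapes \<A> Q s" if "s \<in> P" for s
    using apr_proof_no_escape[OF _ pf] that by blast
  then show "partially_valid \<A> (P \<leadsto> Q)"
    using assms by (intro no_escape_imp_partially_valid) (auto simp: apr_over_def)
next
  fix T :: "('v, 'a) dtree" and \<xi>
  assume "apr_disproof \<A> (P \<leadsto> Q) T \<xi>"
  then obtain v where tree: "derivation_tree \<A> T" and root: "label T (root T) = Pred (P \<leadsto> Q)"
    and v: "v \<in> nodes T" "rule T v = Some Dis"
    by (auto simp: apr_disproof_def apr_pre_proof_def)
  \<comment> \<open>All nodes of a finite tree are reachable from its root.\<close>
  then have "(root T, v) \<in> (edges T)\<^sup>*"
    by (auto simp: derivation_tree_def finite_tree_def)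
  then obtain s where "s \<in> P" "escapes \<A> Q s"
    using Dis_below_imp_escape[OF tree v(2)] root by fastforce
  then show "\<not> partially_valid \<A> (P \<leadsto> Q)"
    using partially_valid_imp_no_escape[of \<A> Q s P] by blast
qed

end
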